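(* Let $X$ be a nonempty set and $f:X\to X$ a function. Assume that there is a ball space $(X,\mathcal{B}^f)$ such that: (B1) each ball in $\mathcal{B}^f$ is $f$-closed; (B2) the intersection of every nest of balls in $\mathcal{B}^f$ is a singleton or contains a smaller ball $B\in\mathcal{B}^f$ (that is, a ball $B\in\mathcal{B}^f$ properly contained in the intersection). Then $f$ admits a fixed point in every ball in $\mathcal{B}^f$.
   Context: A ball space $(X,\mathcal{B})$ consists of a nonempty set $X$ and a nonempty family $\mathcal{B}$ of nonempty subsets of $X$, called balls. A nest of balls is a nonempty subset of $\mathcal{B}$ which is totally ordered by inclusion. For a function $f:X\to X$, a subset $S\subseteq X$ is $f$-closed if $f(S)\subseteq S$. *)

theory Defs
  imports Main "HOL-Library.FuncSet"
begin

definition ball_space :: "'a set \<Rightarrow> 'a set set \<Rightarrow> bool" where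
  "ball_space X \<B> \<longleftrightarrow> X \<noteq> {} \<and> \<B> \<noteq> {} \<and> (\<forall>B\<in>\<B>. B \<noteq> {} \<and> B \<subseteq> X)"

(* subset.chain \<B> N includes the requirement N \<subseteq> \<B>. *)
definition nest_of_balls :: "'a set set \<Rightarrow> 'a set set \<Rightarrow> bool" where
  "nest_of_balls \<B> N \<longleftrightarrow> N \<noteq> {} \<and> subset.chain \<B> N"

definition f_closed :: "('a \<Rightarrow> 'a) \<Rightarrow> 'a set \<Rightarrow> bool" where
  "f_closed f S \<longleftrightarrow> f ` S \<subseteq> S"

end

theory Submission
  imports Defs
begin

text \<open>
  Starting from a ball \<open>B\<close>, the Hausdorff maximal principle yields a maximal nest \<open>N\<close>
  of balls contained in \<open>B\<close>.  No ball lies properly inside \<open>\<Inter>N\<close>: such a ball could be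
  added to \<open>N\<close>, so by maximality it would already be a member of \<open>N\<close> and hence contain
  \<open>\<Inter>N\<close>.  The second alternative of (B2) being excluded, \<open>\<Inter>N\<close> is a singleton, and it is
  \<open>f\<close>-closed because an intersection of \<open>f\<close>-closed sets is; its only point is therefore
  fixed by \<open>f\<close>.  The point lies in \<open>B\<close>, because \<open>B\<close> is comparable with all members of \<open>N\<close>
  and thus, again by maximality, a member itself.
\<close>

text \<open>
  The form in which maximality is used: adjoining an element comparable with all members
  gives a chain again, so it gives nothing new.
\<close>

lemma maxchain_contains_comparable:
  assumes max: "subset.maxchain A N" and "C \<in> A"
    and comparable: "\<And>D. D \<in> N \<Longrightarrow> C \<subseteq> D \<or> D \<subseteq> C"
  shows "C \<in> N"
proof (rule ccontr)
  assume "C \<notin> N"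
  have "subset.chain A (insert C N)"
    using subset.maxchain_imp_chain[OF max] \<open>C \<in> A\<close> comparable
    unfolding subset_chain_def by blast
  with max \<open>C \<notin> N\<close> show False
    unfolding subset.maxchain_def by blast
qed

lemma f_closed_Inter:
  assumes "\<And>B. B \<in> N \<Longrightarrow> f_closed f B"
  shows "f_closed f (\<Inter>N)"
  using assms unfolding f_closed_def by blast

theorem theorem2p4:
  fixes X :: "'a set" and f :: "'a \<Rightarrow> 'a" and \<B> :: "'a set set"
  assumes "X \<noteq> {}"
    and "f \<in> X \<rightarrow> X"
    and "ball_space X \<B>"
    and B1: "\<forall>B\<in>\<B>. f_closed f B"
    and B2: "\<forall>N. nest_of_balls \<B> N \<longrightarrow> is_singleton (\<Inter>N) \<or> (\<exists>B\<in>\<B>. B \<subset> \<Inter>N)"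
  shows "\<forall>B\<in>\<B>. \<exists>x\<in>B. f x = x"
proof
  fix B assume "B \<in> \<B>"
  obtain N where N: "subset.maxchain {C \<in> \<B>. C \<subseteq> B} N"
    using subset.Hausdorff by blast
  have chain: "subset.chain {C \<in> \<B>. C \<subseteq> B} N"
    using N by (rule subset.maxchain_imp_chain)
  then have below: "D \<in> \<B>" "D \<subseteq> B" if "D \<in> N" for D
    using that unfolding subset_chain_def by auto
  have "B \<in> N"
    by (rule maxchain_contains_comparable[OF N]) (use \<open>B \<in> \<B>\<close> below in auto)
  have nest: "nest_of_balls \<B> N"
    using \<open>B \<in> N\<close> chain unfolding nest_of_balls_def subset_chain_def by blast
  have no_smaller: "\<not> C \<subset> \<Inter>N" if "C \<in> \<B>" for C
  proof
    assume C: "C \<subset> \<Inter>N"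
    have "C \<in> N"
      by (rule maxchain_contains_comparable[OF N]) (use that C \<open>B \<in> N\<close> in auto)
    with C show False by blast
  qed
  obtain x where x: "\<Inter>N = {x}"
    using B2 nest no_smaller unfolding is_singleton_def by blast
  have "f_closed f {x}"
    using f_closed_Inter[of N f] B1 below unfolding x by blast
  then have "f x = x"
    unfolding f_closed_def by simp
  moreover have "x \<in> B"
    using x \<open>B \<in> N\<close> by blast
  ultimately show "\<exists>x\<in>B. f x = x" by blast
qed

end
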